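(* Let $A$ be an infinite set of cardinality $\nu$. Then the closure operator $\Lambda_\omega\langle-\rangle\colon\mathcal{P}(\mathcal{O}_A)\to\mathcal{P}(\mathcal{O}_A)$, $F\mapsto\Lambda_\omega(\langle F\rangle)$, is not $\kappa$-algebraic for any infinite regular cardinal $\kappa\le\nu$.
   Context: A clone on a nonempty set $A$ is a set of finitary operations on $A$ that contains all projections and is closed under composition; $\mathcal{O}_A$ is the clone of all finitary operations on $A$ and $\langle F\rangle$ is the clone generated by $F$. An $n$-ary operation $f$ on $A$ is $\lambda$-interpolable by a clone $\mathcal{C}$ if for every $S\subseteq A^n$ with $|S|\le\lambda$ there is an $n$-ary $t\in\mathcal{C}$ with $f|_S=t|_S$. The local closure $\Lambda_\omega(\mathcal{C})$ is the set of all operations on $A$ that are $\lambda$-interpolable by $\mathcal{C}$ for every finite $\lambda$ (it is the least locally closed clone containing $\mathcal{C}$). For an infinite cardinal $\kappa$, a closure operator $X\mapsto\bar X$ on a set $S$ is $\kappa$-algebraic if for every $X\subseteq S$: $X=\bar X$ iff $X=\bigcup\{\bar Y: Y\subseteq X,\ |Y|<\kappa\}$. *)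

theory Defs
  imports Main "HOL-Library.FuncSet" "HOL-Library.NList"
begin

unbundle cardinal_syntax

text \<open>
  An \<open>n\<close>-ary operation on \<open>A\<close> is a pair \<open>(n, f)\<close>, where \<open>f\<close> maps the \<open>n\<close>-tuples over \<open>A\<close>
  (lists of length \<open>n\<close>) into \<open>A\<close> and is \<^const>\<open>undefined\<close> on all other lists. Hence equality
  of pairs is equality of operations. Every arity \<open>n\<close> is allowed, including \<open>n = 0\<close>.
\<close>

type_synonym 'a operation = "nat \<times> ('a list \<Rightarrow> 'a)"

definition all_operations :: "'a set \<Rightarrow> 'a operation set" where
  "all_operations A = {(n, f). f \<in> nlists n A \<rightarrow>\<^sub>E A}"

definition projection :: "'a set \<Rightarrow> nat \<Rightarrow> nat \<Rightarrow> 'a operation" where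
  "projection A n i = (n, \<lambda>xs \<in> nlists n A. xs ! i)"

text \<open>
  The \<open>k\<close>-ary operation \<open>f(g\<^sub>1, \<dots>, g\<^sub>n)\<close>. The arity \<open>k\<close> has to be given separately
  because the list \<open>gs\<close> is empty if \<open>f\<close> is nullary.
\<close>

definition composition ::
    "'a set \<Rightarrow> nat \<Rightarrow> ('a list \<Rightarrow> 'a) \<Rightarrow> ('a list \<Rightarrow> 'a) list \<Rightarrow> 'a operation" where
  "composition A k f gs = (k, \<lambda>xs \<in> nlists k A. f (map (\<lambda>g. g xs) gs))"

definition clone_on :: "'a set \<Rightarrow> 'a operation set \<Rightarrow> bool" where
  "clone_on A C \<longleftrightarrow>
     C \<subseteq> all_operations A \<and>
     (\<forall>n. \<forall>i<n. projection A n i \<in> C) \<and>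
     (\<forall>n k f gs. (n, f) \<in> C \<and> length gs = n \<and> (\<forall>g \<in> set gs. (k, g) \<in> C)
        \<longrightarrow> composition A k f gs \<in> C)"

definition generated_clone :: "'a set \<Rightarrow> 'a operation set \<Rightarrow> 'a operation set" where
  "generated_clone A F = \<Inter> {C. clone_on A C \<and> F \<subseteq> C}"

definition interpolable ::
    "'a set \<Rightarrow> 'l rel \<Rightarrow> 'a operation set \<Rightarrow> nat \<Rightarrow> ('a list \<Rightarrow> 'a) \<Rightarrow> bool" where
  "interpolable A \<mu> C n f \<longleftrightarrow>
     (\<forall>S \<subseteq> nlists n A. |S| \<le>o \<mu> \<longrightarrow> (\<exists>t. (n, t) \<in> C \<and> (\<forall>xs \<in> S. f xs = t xs)))"

text \<open>The finite cardinals \<open>\<mu>\<close> are represented by \<open>|{..<m}|\<close> for natural numbers \<open>m\<close>.\<close>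

definition local_closure :: "'a set \<Rightarrow> 'a operation set \<Rightarrow> 'a operation set" where
  "local_closure A C =
     {(n, f) \<in> all_operations A. \<forall>m::nat. interpolable A |{..<m}| C n f}"

text \<open>
  That \<open>cl\<close> is a closure operator on \<open>S\<close> is deliberately not part of the following predicate,
  so that its negation asserts failure of the stated equivalence and nothing else.
\<close>

definition algebraic_on :: "'k rel \<Rightarrow> 'b set \<Rightarrow> ('b set \<Rightarrow> 'b set) \<Rightarrow> bool" where
  "algebraic_on \<kappa> S cl \<longleftrightarrow>
     (\<forall>X \<subseteq> S. X = cl X \<longleftrightarrow> X = \<Union> {cl Y | Y. Y \<subseteq> X \<and> |Y| <o \<kappa>})"

end

theory Submission
  imports Defs
begin

text \<open>
  Let \<open>X\<close> consist of the operations \<open>f\<close> for which \<open>f(x, \<dots>, x) = x\<close>, that is, \<open>f\<close> preserves \<open>{x}\<close>,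
  for all but fewer than \<open>\<kappa>\<close> elements \<open>x\<close>. If \<open>Y \<subseteq> X\<close> has fewer than \<open>\<kappa>\<close> elements, then by
  regularity the exceptional points of all members of \<open>Y\<close> form a set \<open>U\<close> with \<open>|U| < \<kappa>\<close>. The
  operations that preserve \<open>{x}\<close> for every \<open>x\<close> outside \<open>U\<close> form a locally closed clone between
  \<open>Y\<close> and \<open>X\<close>, so the closure of \<open>Y\<close> lies in \<open>X\<close>. However, \<open>X\<close> is not closed: a unary constant
  operation is not in \<open>X\<close>, but on each finite set it agrees with an operation that is the
  identity elsewhere.
\<close>

lemma generated_clone_superset: "F \<subseteq> generated_clone A F"
  unfolding generated_clone_def by blast

lemma generated_clone_least: "clone_on A C \<Longrightarrow> F \<subseteq> C \<Longrightarrow> generated_clone A F \<subseteq> C"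
  unfolding generated_clone_def by blast

lemma mem_local_closure_iff:
  "(n, f) \<in> local_closure A C \<longleftrightarrow>
     (n, f) \<in> all_operations A \<and>
     (\<forall>S \<subseteq> nlists n A. finite S \<longrightarrow> (\<exists>t. (n, t) \<in> C \<and> (\<forall>xs \<in> S. f xs = t xs)))"
proof -
  have finite_iff: "finite S \<longleftrightarrow> (\<exists>m::nat. |S| \<le>o |{..<m}| )" for S :: "'a list set"
  proof
    assume "finite S"
    then obtain h and m :: nat where "h ` S = {i. i < m}" and "inj_on h S"
      by (metis finite_imp_inj_to_nat_seg)
    then have "|S| \<le>o |{..<m}|"
      by (intro card_of_ordLeqI[of h]) auto
    then show "\<exists>m::nat. |S| \<le>o |{..<m}|" ..
  qed (use card_of_ordLeq_finite in blast)
  show ?thesis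
    unfolding local_closure_def interpolable_def finite_iff by blast
qed

lemma local_closure_mono: "C \<subseteq> D \<Longrightarrow> local_closure A C \<subseteq> local_closure A D"
  by (auto simp: mem_local_closure_iff) blast

lemma local_closure_superset: "C \<subseteq> all_operations A \<Longrightarrow> C \<subseteq> local_closure A C"
  by (auto simp: mem_local_closure_iff)

lemma local_closure_generated_clone_least:
  assumes "clone_on A C" and "local_closure A C \<subseteq> C" and "F \<subseteq> C"
  shows "local_closure A (generated_clone A F) \<subseteq> C"
  using local_closure_mono[OF generated_clone_least[OF assms(1,3)]] assms(2) by (rule order_trans)

definition preserves :: "'a operation \<Rightarrow> 'a set \<Rightarrow> bool" where
  "preserves p B \<longleftrightarrow> snd p \<in> nlists (fst p) B \<rightarrow> B"

lemma preserves_singleton_iff: "preserves (n, f) {x} \<longleftrightarrow> f (replicate n x) = x"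
  by (simp add: preserves_def nlists_singleton)

definition operations_preserving :: "'a set \<Rightarrow> 'a set set \<Rightarrow> 'a operation set" where
  "operations_preserving A \<B> = {p \<in> all_operations A. \<forall>B \<in> \<B>. preserves p B}"

lemma operations_preserving_antimono:
  "\<B> \<subseteq> \<C> \<Longrightarrow> operations_preserving A \<C> \<subseteq> operations_preserving A \<B>"
  unfolding operations_preserving_def by blast

lemma preserves_projection:
  assumes "i < n" and "B \<subseteq> A"
  shows "preserves (projection A n i) B"
  using assms nlists_mono[OF assms(2), of n]
  by (auto simp: preserves_def projection_def nlistsE_nth_in)

lemma preserves_composition:
  assumes f: "preserves (length gs, f) B"
    and gs: "\<forall>g \<in> set gs. preserves (k, g) B"
    and "B \<subseteq> A"
  shows "preserves (composition A k f gs) B"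
proof -
  have "f (map (\<lambda>g. g xs) gs) \<in> B" if "xs \<in> nlists k B" for xs
  proof -
    have "map (\<lambda>g. g xs) gs \<in> nlists (length gs) B"
      using gs that by (auto simp: preserves_def)
    then show ?thesis
      using f by (auto simp: preserves_def)
  qed
  then show ?thesis
    using nlists_mono[OF \<open>B \<subseteq> A\<close>, of k] by (auto simp: preserves_def composition_def)
qed

lemma mem_all_operations_iff:
  "(n, f) \<in> all_operations A \<longleftrightarrow> f \<in> extensional (nlists n A) \<and> preserves (n, f) A"
  by (auto simp: all_operations_def preserves_def PiE_def)

lemma clone_on_operations_preserving:
  assumes "\<B> \<subseteq> Pow A"
  shows "clone_on A (operations_preserving A \<B>)"
  unfolding clone_on_def
proof (intro conjI allI impI)
  show "operations_preserving A \<B> \<subseteq> all_operations A"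
    by (auto simp: operations_preserving_def)
next
  fix n i :: nat
  assume "i < n"
  then have "preserves (projection A n i) B" if "B \<subseteq> A" for B
    using that by (rule preserves_projection)
  then show "projection A n i \<in> operations_preserving A \<B>"
    using assms
    by (auto simp: operations_preserving_def projection_def mem_all_operations_iff)
next
  fix n k :: nat and f gs
  assume "(n, f) \<in> operations_preserving A \<B> \<and> length gs = n
      \<and> (\<forall>g \<in> set gs. (k, g) \<in> operations_preserving A \<B>)"
  then have "preserves (composition A k f gs) B" if "B \<in> insert A \<B>" for B
    using that assms
    by (intro preserves_composition)
      (auto simp: operations_preserving_def mem_all_operations_iff)
  then show "composition A k f gs \<in> operations_preserving A \<B>"
    by (auto simp: operations_preserving_def composition_def mem_all_operations_iff)
qed

lemma clone_on_all_operations: "clone_on A (all_operations A)"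
  using clone_on_operations_preserving[of "{}" A] by (simp add: operations_preserving_def)

lemma local_closure_generated_clone_superset:
  assumes "F \<subseteq> all_operations A"
  shows "F \<subseteq> local_closure A (generated_clone A F)"
  using generated_clone_superset
    local_closure_superset[OF generated_clone_least[OF clone_on_all_operations assms]]
  by (rule order_trans)

lemma local_closure_operations_preserving:
  assumes "\<B> \<subseteq> Pow A"
  shows "local_closure A (operations_preserving A \<B>) \<subseteq> operations_preserving A \<B>"
proof (rule subrelI)
  fix n f
  assume f: "(n, f) \<in> local_closure A (operations_preserving A \<B>)"
  have "f xs \<in> B" if B: "B \<in> \<B>" and xs: "xs \<in> nlists n B" for B xs
  proof -
    have "finite {xs}" and "{xs} \<subseteq> nlists n A"
      using xs nlists_mono[of B A n] B assms by auto
    then obtain t where "(n, t) \<in> operations_preserving A \<B>" and "f xs = t xs"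
      using f unfolding mem_local_closure_iff by blast
    then show ?thesis
      using B xs by (auto simp: operations_preserving_def preserves_def)
  qed
  then show "(n, f) \<in> operations_preserving A \<B>"
    using f by (auto simp: mem_local_closure_iff operations_preserving_def preserves_def)
qed

lemma finite_ordLess_Cinfinite: "finite S \<Longrightarrow> Cinfinite \<kappa> \<Longrightarrow> |S| <o \<kappa>"
  by (rule Cfinite_ordLess_Cinfinite)
    (simp_all add: cfinite_def Field_card_of card_of_card_order_on)

lemma algebraic_on_imp_closed:
  assumes "algebraic_on \<kappa> S cl" and "Cinfinite \<kappa>" and "X \<subseteq> S"
    and extensive: "\<And>Y. Y \<subseteq> S \<Longrightarrow> Y \<subseteq> cl Y"
    and small: "\<And>Y. Y \<subseteq> X \<Longrightarrow> |Y| <o \<kappa> \<Longrightarrow> cl Y \<subseteq> X"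
  shows "cl X = X"
proof -
  have "x \<in> cl {x}" and "|{x}| <o \<kappa>" if "x \<in> X" for x
    using that extensive[of "{x}"] assms(2,3) by (auto intro: finite_ordLess_Cinfinite)
  then have "X \<subseteq> \<Union> {cl Y | Y. Y \<subseteq> X \<and> |Y| <o \<kappa>}"
    by blast
  moreover have "\<Union> {cl Y | Y. Y \<subseteq> X \<and> |Y| <o \<kappa>} \<subseteq> X"
    using small by blast
  ultimately show ?thesis
    using assms(1,3) unfolding algebraic_on_def by blast
qed

definition operations_preserving_almost_all ::
    "'k rel \<Rightarrow> 'a set \<Rightarrow> ('i \<Rightarrow> 'a set) \<Rightarrow> 'i set \<Rightarrow> 'a operation set" where
  "operations_preserving_almost_all \<kappa> A B I =
     (\<Union>U \<in> {U. |U| <o \<kappa>}. operations_preserving A (B ` (I - U)))"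

lemma operations_preserving_almost_all_subset:
  "operations_preserving_almost_all \<kappa> A B I \<subseteq> all_operations A"
  by (auto simp: operations_preserving_almost_all_def operations_preserving_def)

lemma local_closure_generated_clone_subset_preserving_almost_all:
  assumes "Cinfinite \<kappa>" and "regularCard \<kappa>" and "B ` I \<subseteq> Pow A"
    and Y: "Y \<subseteq> operations_preserving_almost_all \<kappa> A B I" and small: "|Y| <o \<kappa>"
  shows "local_closure A (generated_clone A Y) \<subseteq> operations_preserving_almost_all \<kappa> A B I"
proof -
  from Y have "\<forall>p \<in> Y. \<exists>U. |U| <o \<kappa> \<and> p \<in> operations_preserving A (B ` (I - U))"
    by (auto simp: operations_preserving_almost_all_def)
  then obtain U where U: "\<forall>p \<in> Y. |U p| <o \<kappa> \<and> p \<in> operations_preserving A (B ` (I - U p))"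
    by metis
  define V where "V = (\<Union>p \<in> Y. U p)"
  have "Y \<subseteq> operations_preserving A (B ` (I - V))"
  proof
    fix p
    assume "p \<in> Y"
    then have "p \<in> operations_preserving A (B ` (I - U p))" and "B ` (I - V) \<subseteq> B ` (I - U p)"
      using U by (auto simp: V_def)
    then show "p \<in> operations_preserving A (B ` (I - V))"
      by (rule subsetD[OF operations_preserving_antimono, rotated])
  qed
  moreover have "B ` (I - V) \<subseteq> Pow A"
    using assms(3) by blast
  ultimately have
    "local_closure A (generated_clone A Y) \<subseteq> operations_preserving A (B ` (I - V))"
    by (intro local_closure_generated_clone_least clone_on_operations_preserving
        local_closure_operations_preserving)
  moreover have "|V| <o \<kappa>"
    unfolding V_def using U small assms(1,2) by (intro regularCard_UNION_bound) auto
  ultimately show ?thesis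
    by (auto simp: operations_preserving_almost_all_def)
qed

abbreviation almost_idempotent_operations :: "'k rel \<Rightarrow> 'a set \<Rightarrow> 'a operation set" where
  "almost_idempotent_operations \<kappa> A \<equiv> operations_preserving_almost_all \<kappa> A (\<lambda>x. {x}) A"

lemma nonnullary_mem_local_closure_almost_idempotent:
  assumes "Cinfinite \<kappa>" and "0 < n" and f: "(n, f) \<in> all_operations A"
  shows "(n, f) \<in> local_closure A (almost_idempotent_operations \<kappa> A)"
  unfolding mem_local_closure_iff
proof (intro conjI allI impI)
  fix S
  assume S: "S \<subseteq> nlists n A" and "finite S"
  define t where "t = (\<lambda>xs \<in> nlists n A. if xs \<in> S then f xs else hd xs)"
  have "hd xs \<in> A" if "xs \<in> nlists n A" for xs
    using that \<open>0 < n\<close> by (cases n) (auto simp: in_nlists_Suc_iff)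
  then have "(n, t) \<in> all_operations A"
    using f by (auto simp: all_operations_def t_def)
  moreover have "preserves (n, t) {x}" if x: "x \<in> A - hd ` S" for x
  proof -
    have "hd (replicate n x) = x"
      using \<open>0 < n\<close> by simp
    moreover from this have "replicate n x \<notin> S"
      using x by force
    ultimately show ?thesis
      using x by (auto simp: preserves_singleton_iff t_def)
  qed
  ultimately have "(n, t) \<in> operations_preserving A ((\<lambda>x. {x}) ` (A - hd ` S))"
    by (auto simp: operations_preserving_def)
  moreover have "|hd ` S| <o \<kappa>"
    using \<open>finite S\<close> assms(1) by (simp add: finite_ordLess_Cinfinite)
  ultimately have "(n, t) \<in> almost_idempotent_operations \<kappa> A"
    by (auto simp: operations_preserving_almost_all_def)
  moreover have "\<forall>xs \<in> S. f xs = t xs"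
    using S by (auto simp: t_def)
  ultimately show "\<exists>t. (n, t) \<in> almost_idempotent_operations \<kappa> A \<and> (\<forall>xs \<in> S. f xs = t xs)"
    by blast
qed (fact f)

lemma constant_not_almost_idempotent:
  assumes "Cinfinite \<kappa>" and "\<kappa> \<le>o |A|"
  shows "(n, \<lambda>xs \<in> nlists n A. c) \<notin> almost_idempotent_operations \<kappa> A"
proof
  assume "(n, \<lambda>xs \<in> nlists n A. c) \<in> almost_idempotent_operations \<kappa> A"
  then obtain U where "|U| <o \<kappa>" and "\<forall>x \<in> A - U. preserves (n, \<lambda>xs \<in> nlists n A. c) {x}"
    by (auto simp: operations_preserving_almost_all_def operations_preserving_def)
  then have "A \<subseteq> U \<union> {c}"
    by (auto simp: preserves_singleton_iff nlists_replicateI)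
  moreover have "|U \<union> {c}| <o \<kappa>"
    using \<open>|U| <o \<kappa>\<close> assms(1) finite_ordLess_Cinfinite[of "{c}" \<kappa>]
    by (intro card_of_Un_ordLess_infinite_Field) (auto simp: cinfinite_def)
  ultimately have "|A| <o \<kappa>"
    using card_of_mono1 ordLeq_ordLess_trans by blast
  then show False
    using assms(2) not_ordLess_ordLeq by blast
qed

theorem theorem6p3:
  fixes A :: "'a set" and \<kappa> :: "'k rel"
  assumes "infinite A"
    and "Cinfinite \<kappa>" and "regularCard \<kappa>"
    and "\<kappa> \<le>o |A|"
  shows "\<not> algebraic_on \<kappa> (all_operations A)
             (\<lambda>F. local_closure A (generated_clone A F))"
proof
  let ?X = "almost_idempotent_operations \<kappa> A"
  assume "algebraic_on \<kappa> (all_operations A) (\<lambda>F. local_closure A (generated_clone A F))"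
  then have closed: "local_closure A (generated_clone A ?X) = ?X"
    using assms(2) operations_preserving_almost_all_subset local_closure_generated_clone_superset
  proof (rule algebraic_on_imp_closed)
    show "local_closure A (generated_clone A Y) \<subseteq> ?X" if "Y \<subseteq> ?X" "|Y| <o \<kappa>" for Y
      using assms(2,3) _ that
      by (rule local_closure_generated_clone_subset_preserving_almost_all) auto
  qed
  obtain c where "c \<in> A"
    using assms(1) by fastforce
  define const where "const = (\<lambda>xs \<in> nlists 1 A. c)"
  have "(1, const) \<in> all_operations A"
    using \<open>c \<in> A\<close> by (auto simp: all_operations_def const_def)
  then have "(1, const) \<in> local_closure A ?X"
    using assms(2) by (simp add: nonnullary_mem_local_closure_almost_idempotent)
  also have "\<dots> \<subseteq> local_closure A (generated_clone A ?X)"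
    by (intro local_closure_mono generated_clone_superset)
  finally have "(1, const) \<in> ?X"
    by (simp only: closed)
  then show False
    using constant_not_almost_idempotent[OF assms(2,4)] by (simp only: const_def)
qed

end
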